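(* Let $(\xi_n)_{n=0}^\infty$ be a sequence of independent Bernoulli random variables such that $\xi_n=1$ with probability $\frac{1}{n+1}$ and $\xi_n=0$ with probability $1-\frac1{n+1}$. Then almost surely the function $f_\xi(z)=\sum_{n=0}^\infty\xi_nz^n$, $z\in\mathbb{D}$, does not belong to the Bloch space $\mathcal{B}$. Equivalently, almost surely the subset $\Lambda_\xi:=\{n\in\mathbb{N}:\xi_n=1\}$ is not a finite union of lacunary subsets of $\mathbb{N}$.
   Context: $\mathbb{N}=\{0,1,2,\dots\}$; $\mathbb{D}$ is the open unit disc in $\mathbb{C}$. Bloch space: $\mathcal{B}=\{f \text{ holomorphic on } \mathbb{D} : \|f\|_{\mathcal{B}}:=\sup_{z\in\mathbb{D}}(1-|z|)|f'(z)|<\infty\}$. Lacunary: a subset $\Lambda=\{\lambda_1,\lambda_2,\dots\}\subset\mathbb{N}$ with $\lambda_1<\lambda_2<\cdots$ is lacunary if $\liminf_{k\to\infty}\lambda_{k+1}/\lambda_k>1$. Finite subsets (including the empty set) are regarded as lacunary. *)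

theory Defs
  imports "HOL-Complex_Analysis.Complex_Analysis" "HOL-Probability.Probability"
begin

definition bloch_norm :: "(complex \<Rightarrow> complex) \<Rightarrow> ereal" where
  "bloch_norm f = (SUP z\<in>ball 0 1. ereal ((1 - norm z) * norm (deriv f z)))"

text \<open>Only the values of a function on the open unit disc matter for membership.\<close>

definition bloch_space :: "(complex \<Rightarrow> complex) set" where
  "bloch_space = {f. f holomorphic_on ball 0 1 \<and> bloch_norm f < \<infinity>}"

text \<open>For infinite \<open>L\<close>, \<open>enumerate L\<close> lists its elements in increasing order, starting with
  index 0. If \<open>0 \<in> L\<close>, the first quotient is a division by zero; this does not affect the
  limit inferior.\<close>

definition lacunary :: "nat set \<Rightarrow> bool" where
  "lacunary L \<longleftrightarrow> finite L \<or>
     liminf (\<lambda>k. ereal (real (enumerate L (Suc k)) / real (enumerate L k))) > 1"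

definition finite_union_of_lacunary :: "nat set \<Rightarrow> bool" where
  "finite_union_of_lacunary L \<longleftrightarrow>
     (\<exists>F. finite F \<and> (\<forall>A\<in>F. lacunary A) \<and> L = \<Union>F)"

definition power_series :: "(nat \<Rightarrow> real) \<Rightarrow> complex \<Rightarrow> complex" where
  "power_series x z = (\<Sum>n. of_real (x n) * z ^ n)"

end

theory Submission
  imports Defs
begin

text \<open>A set is a finite union of lacunary sets iff the number of its elements in a dyadic interval
  \<open>[x, 2x)\<close> is bounded. As the coefficients are nonnegative, the Bloch condition needs to be tested
  on the positive radius only, where at \<open>1 - 1/(2x)\<close> it bounds the number of exponents in
  \<open>[x, 2x)\<close>; conversely, bounded dyadic counts give \<open>\<Sum>k\<le>N, k\<in>L. k \<le> C N\<close>, and summation by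
  parts yields the Bloch condition.

  For the random set, \<open>P (\<Lambda> \<inter> [a, b) = {}) = a/b\<close> by telescoping. Hence for each \<open>m\<close> the
  interval \<open>[m 2^j, m 2^(j+1))\<close> contains at least \<open>m\<close> elements with a probability bounded below
  independently of \<open>j\<close>, and by independence this almost surely happens for some \<open>j\<close>.\<close>

section \<open>Lacunary sets and dyadic counts\<close>

definition dyadically_bounded :: "nat set \<Rightarrow> bool" where
  "dyadically_bounded L \<longleftrightarrow> (\<exists>K. \<forall>x. card (L \<inter> {x..<2 * x}) \<le> K)"

text \<open>Consecutive enumerated elements are pairs covered by \<open>ratio\<close>. The case
  \<open>a = 0\<close> is excluded there because 0 can only be enumerated at index 0, which the
  limit inferior ignores.\<close>

lemma lacunary_if_ratio_ge:
  assumes q: "q > 1" and ratio: "\<And>a b. a \<in> L \<Longrightarrow> b \<in> L \<Longrightarrow> 0 < a \<Longrightarrow> a < b \<Longrightarrow> real b \<ge> q * real a"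
  shows "lacunary L"
proof (cases "finite L")
  case False
  have "ereal q \<le> ereal (real (enumerate L (Suc k)) / real (enumerate L k))" if "k \<ge> 1" for k
  proof -
    have "enumerate L k > 0"
      using that False enumerate_mono[of 0 k L] by linarith
    moreover have "enumerate L k < enumerate L (Suc k)"
      using False by (simp add: enumerate_step)
    ultimately show ?thesis
      using ratio[of "enumerate L k" "enumerate L (Suc k)"] False
      by (simp add: enumerate_in_set field_simps)
  qed
  then have "ereal q \<le> liminf (\<lambda>k. ereal (real (enumerate L (Suc k)) / real (enumerate L k)))"
    by (intro Liminf_bounded) (auto simp: eventually_sequentially)
  moreover from q have "1 < ereal q" by simp
  ultimately have "1 < liminf (\<lambda>k. ereal (real (enumerate L (Suc k)) / real (enumerate L k)))"
    by (rule less_le_trans[rotated])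
  then show ?thesis by (simp add: lacunary_def)
qed (simp add: lacunary_def)

text \<open>From some index \<open>N\<close> on, the enumeration grows at least geometrically with a
  ratio \<open>q > 1\<close>. If \<open>q ^ p > 2\<close>, then \<open>p\<close> steps more than
  double an element, so an interval \<open>{x..<2 * x}\<close> meets at most \<open>p\<close> late
  indices besides the \<open>N\<close> early ones.\<close>

lemma dyadically_bounded_if_lacunary:
  assumes "lacunary L"
  shows "dyadically_bounded L"
proof (cases "finite L")
  case True
  then have "\<forall>x. card (L \<inter> {x..<2 * x}) \<le> card L"
    by (auto intro: card_mono)
  then show ?thesis unfolding dyadically_bounded_def by blast
next
  case False
  let ?e = "enumerate L"
  from assms False have "1 < liminf (\<lambda>k. ereal (real (?e (Suc k)) / real (?e k)))"
    by (simp add: lacunary_def)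
  then obtain y where y: "1 < y" "y < liminf (\<lambda>k. ereal (real (?e (Suc k)) / real (?e k)))"
    using dense by blast
  then obtain q where q: "y = ereal q" by (cases y) auto
  have "\<forall>\<^sub>F k in sequentially. y < ereal (real (?e (Suc k)) / real (?e k))"
    using y(2) by (simp add: less_LiminfD)
  then obtain N where N: "\<And>k. k \<ge> N \<Longrightarrow> q < real (?e (Suc k)) / real (?e k)"
    using q by (auto simp: eventually_sequentially)
  have q1: "q > 1" using y(1) q by simp
  have step: "real (?e (Suc k)) \<ge> q * real (?e k)" if "k \<ge> N" for k
    using N[OF that] q1 by (cases "?e k = 0") (auto simp: field_simps)
  have grow: "real (?e (k + j)) \<ge> q ^ j * real (?e k)" if "k \<ge> N" for k j
  proof (induction j)
    case (Suc j)
    have "q ^ Suc j * real (?e k) = q * (q ^ j * real (?e k))" by simp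
    also have "\<dots> \<le> q * real (?e (k + j))" using Suc q1 by simp
    also have "\<dots> \<le> real (?e (Suc (k + j)))" using step[of "k + j"] that by simp
    finally show ?case by simp
  qed simp
  obtain p where p: "q ^ p > 2" using real_arch_pow[OF q1] by blast
  have "card (L \<inter> {x..<2 * x}) \<le> N + p" for x
  proof -
    define I where "I = {k. k \<ge> N \<and> ?e k \<in> {x..<2 * x}}"
    \<comment> \<open>The window starts at the least index in \<open>I\<close>: its element is at
      least \<open>x\<close>, so \<open>p\<close> steps later the enumeration has reached
      \<open>2 * x\<close>.\<close>
    have "\<exists>k0. I \<subseteq> {k0..<k0 + p}"
    proof (cases "I = {}")
      case False
      define k0 where "k0 = (LEAST k. k \<in> I)"
      have k0: "k0 \<in> I" using False unfolding k0_def by (meson LeastI ex_in_conv)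
      have "k \<in> {k0..<k0 + p}" if k: "k \<in> I" for k
      proof (rule ccontr)
        assume "k \<notin> {k0..<k0 + p}"
        moreover have "k0 \<le> k" using k unfolding k0_def by (rule Least_le)
        ultimately have "k0 + p \<le> k" by simp
        then obtain d where d: "k = k0 + p + d" using le_Suc_ex by blast
        have "2 * real (?e k0) \<le> q ^ p * real (?e k0)" using p by (intro mult_right_mono) auto
        also have "\<dots> \<le> real (?e (k0 + p))" using grow k0 by (simp add: I_def)
        also have "\<dots> \<le> real (?e k)"
          using \<open>infinite L\<close> d by (simp add: enumerate_mono_le_iff)
        finally have "2 * ?e k0 \<le> ?e k" by linarith
        then show False using k k0 by (auto simp: I_def)
      qed
      then show ?thesis by blast
    qed auto
    then obtain k0 where k0: "I \<subseteq> {k0..<k0 + p}" ..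
    have "L \<inter> {x..<2 * x} \<subseteq> ?e ` ({..<N} \<union> {k0..<k0 + p})"
    proof
      fix n assume n: "n \<in> L \<inter> {x..<2 * x}"
      then obtain k where "n = ?e k" using enumerate_Ex[of L n] \<open>infinite L\<close> by auto
      moreover from this n have "k \<in> {..<N} \<union> {k0..<k0 + p}"
        using k0 by (cases "k < N") (auto simp: I_def subset_iff)
      ultimately show "n \<in> ?e ` ({..<N} \<union> {k0..<k0 + p})" by (rule image_eqI)
    qed
    then have "card (L \<inter> {x..<2 * x}) \<le> card ({..<N} \<union> {k0..<k0 + p})"
      by (meson card_image_le card_mono finite.emptyI finite_UnI finite_atLeastLessThan
          finite_imageI finite_lessThan le_trans)
    also have "\<dots> \<le> N + p" using card_Un_le[of "{..<N}" "{k0..<k0 + p}"] by simp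
    finally show ?thesis .
  qed
  then show ?thesis unfolding dyadically_bounded_def by blast
qed

lemma dyadically_bounded_Un:
  assumes "dyadically_bounded A" "dyadically_bounded B"
  shows "dyadically_bounded (A \<union> B)"
proof -
  obtain K where K: "\<And>x. card (A \<inter> {x..<2 * x}) \<le> K"
    using assms(1) unfolding dyadically_bounded_def by blast
  obtain K' where K': "\<And>x. card (B \<inter> {x..<2 * x}) \<le> K'"
    using assms(2) unfolding dyadically_bounded_def by blast
  have "card ((A \<union> B) \<inter> {x..<2 * x}) \<le> K + K'" for x
    using card_Un_le[of "A \<inter> {x..<2 * x}" "B \<inter> {x..<2 * x}"] K[of x] K'[of x]
    by (simp add: Int_Un_distrib2)
  then show ?thesis unfolding dyadically_bounded_def by blast
qed

lemma dyadically_bounded_Union: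
  assumes "finite F" "\<And>A. A \<in> F \<Longrightarrow> dyadically_bounded A"
  shows "dyadically_bounded (\<Union>F)"
  using assms
proof (induction F rule: finite_induct)
  case empty
  then show ?case by (auto simp: dyadically_bounded_def)
qed (simp add: dyadically_bounded_Un)

text \<open>Split \<open>L\<close> according to the rank of its elements modulo a bound \<open>m\<close> of the dyadic counts:
  two members of the same class have at least \<open>m\<close> elements of \<open>L\<close> from the smaller one
  (inclusive) to the larger one (exclusive), so they cannot lie in a common interval \<open>[x, 2x)\<close>.\<close>

lemma finite_union_of_lacunary_if_dyadically_bounded:
  assumes "dyadically_bounded L"
  shows "finite_union_of_lacunary L"
proof -
  obtain K where K: "\<And>x. card (L \<inter> {x..<2 * x}) \<le> K"
    using assms unfolding dyadically_bounded_def by blast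
  \<comment> \<open>The successor makes \<open>m\<close> a strict bound, so \<open>m\<close>
    elements in \<open>{a..<b}\<close> contradict \<open>b < 2 * a\<close>.\<close>
  define m where "m = Suc K"
  define rk where "rk n = card (L \<inter> {..<n})" for n
  define C where "C i = {n \<in> L. rk n mod m = i}" for i
  have "lacunary (C i)" for i
  proof (rule lacunary_if_ratio_ge[of 2])
    fix a b assume ab: "a \<in> C i" "b \<in> C i" "0 < a" "a < b"
    have split: "rk b = rk a + card (L \<inter> {a..<b})"
    proof -
      have "L \<inter> {..<b} = (L \<inter> {..<a}) \<union> (L \<inter> {a..<b})" using ab by auto
      moreover have "(L \<inter> {..<a}) \<inter> (L \<inter> {a..<b}) = {}" by auto
      ultimately show ?thesis unfolding rk_def by (simp add: card_Un_disjoint)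
    qed
    \<comment> \<open>A multiple of \<open>m\<close> is at least \<open>m\<close> only if it is
      nonzero; the element \<open>a\<close> itself ensures this.\<close>
    have "a \<in> L \<inter> {a..<b}" using ab by (auto simp: C_def)
    then have pos: "card (L \<inter> {a..<b}) > 0" by (auto simp: card_gt_0_iff)
    have "m dvd rk b - rk a"
      using ab split by (intro mod_eq_dvd_iff_nat[THEN iffD1]) (auto simp: C_def)
    then have "m \<le> card (L \<inter> {a..<b})" using split pos by (simp add: dvd_imp_le)
    moreover have "card (L \<inter> {a..<b}) \<le> card (L \<inter> {a..<2 * a})" if "b < 2 * a"
      using that by (intro card_mono) auto
    ultimately have "\<not> b < 2 * a" using K[of a] by (auto simp: m_def)
    then show "real b \<ge> 2 * real a" by linarith
  qed simp
  moreover have "L = \<Union>(C ` {..<m})" by (auto simp: C_def m_def)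
  ultimately show ?thesis unfolding finite_union_of_lacunary_def
    by (intro exI[of _ "C ` {..<m}"]) auto
qed

lemma finite_union_of_lacunary_iff_dyadically_bounded:
  "finite_union_of_lacunary L \<longleftrightarrow> dyadically_bounded L"
proof
  assume "finite_union_of_lacunary L"
  then show "dyadically_bounded L"
    unfolding finite_union_of_lacunary_def
    by (auto intro: dyadically_bounded_Union dyadically_bounded_if_lacunary)
qed (rule finite_union_of_lacunary_if_dyadically_bounded)

section \<open>Power series with coefficients 0 and 1, and their derivatives\<close>

lemma summable_derivative_indicator_series:
  fixes z :: "'a :: {real_normed_field, banach}"
  assumes "norm z < 1"
  shows "summable (\<lambda>n. of_nat (Suc n) * indicator L (Suc n) * z ^ n)"
proof -
  have "summable (\<lambda>n. diffs (indicator L :: nat \<Rightarrow> 'a) n * z ^ n)"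
  proof (rule termdiff_converges[OF assms])
    fix y :: 'a assume y: "norm y < 1"
    show "summable (\<lambda>n. indicator L n * y ^ n)"
    proof (rule summable_comparison_test[OF _ summable_geometric[of "norm y"]])
      show "\<exists>N. \<forall>n\<ge>N. norm (indicator L n * y ^ n) \<le> norm y ^ n"
        by (auto simp: norm_mult norm_power indicator_def)
    qed (use y in auto)
  qed
  then show ?thesis by (simp add: diffs_def)
qed

lemma has_field_derivative_power_series_indicator:
  assumes z: "norm z < 1"
  shows "(power_series (indicator L) has_field_derivative
           (\<Sum>n. of_nat (Suc n) * indicator L (Suc n) * z ^ n)) (at z)"
proof -
  \<comment> \<open>Termwise differentiation at \<open>z\<close> needs convergence at a point of
    larger modulus, here \<open>r\<close>.\<close>
  obtain r where r: "norm z < r" "r < 1" using z dense by blast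
  have r0: "r > 0" using r(1) norm_ge_zero[of z] by linarith
  have "summable (\<lambda>n. of_real (indicator L n) * (of_real r :: complex) ^ n)"
  proof (rule summable_comparison_test[OF _ summable_geometric[of r]])
    show "\<exists>N. \<forall>n\<ge>N. norm (of_real (indicator L n) * (of_real r :: complex) ^ n) \<le> r ^ n"
      using r0 by (auto simp: norm_mult norm_power indicator_def)
  qed (use r r0 in auto)
  from termdiffs_strong[OF this, of z] r r0
  have "((\<lambda>z. \<Sum>n. of_real (indicator L n) * z ^ n) has_field_derivative
         (\<Sum>n. diffs (\<lambda>n. of_real (indicator L n)) n * z ^ n)) (at z)"
    by simp
  moreover have "(\<lambda>n. diffs (\<lambda>n. of_real (indicator L n) :: complex) n * z ^ n) =
      (\<lambda>n. of_nat (Suc n) * indicator L (Suc n) * z ^ n)"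
    by (auto simp: diffs_def indicator_def)
  ultimately show ?thesis unfolding power_series_def[abs_def] by simp
qed

lemma deriv_power_series_indicator:
  "norm z < 1 \<Longrightarrow> deriv (power_series (indicator L)) z =
    (\<Sum>n. of_nat (Suc n) * indicator L (Suc n) * z ^ n)"
  by (rule DERIV_imp_deriv[OF has_field_derivative_power_series_indicator])

lemma holomorphic_power_series_indicator:
  "power_series (indicator L) holomorphic_on ball 0 1"
proof (rule holomorphic_onI)
  fix z :: complex assume "z \<in> ball 0 1"
  then have "(power_series (indicator L) has_field_derivative
      (\<Sum>n. of_nat (Suc n) * indicator L (Suc n) * z ^ n)) (at z)"
    by (intro has_field_derivative_power_series_indicator) simp
  then show "power_series (indicator L) field_differentiable at z within ball 0 1"
    unfolding field_differentiable_def by (blast intro: has_field_derivative_at_within)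
qed

section \<open>The Bloch condition in terms of dyadic counts\<close>

lemma sum_indicator_real_eq_card:
  "finite A \<Longrightarrow> (\<Sum>k\<in>A. indicator L k) = real (card (L \<inter> A))"
  by (induction A rule: finite_induct) (auto simp: indicator_def Int_insert_right)

text \<open>Halving \<open>N\<close>: the upper half fits in one dyadic interval and contributes at
  most \<open>K * N\<close>, while by induction the lower half contributes at most
  \<open>2 * K * (N div 2)\<close>, which is again at most \<open>K * N\<close>.\<close>

lemma sum_indicator_le_linear:
  assumes K: "\<And>x. card (L \<inter> {x..<2 * x}) \<le> K"
  shows "(\<Sum>k=1..N. real k * indicator L k) \<le> 2 * real K * real N"
proof (induction N rule: less_induct)
  case (less N)
  show ?case
  proof (cases "N = 0")
    case False
    define h where "h = N div 2"
    have h: "h < N" "N \<le> 2 * h + 1" "2 * h \<le> N" using False by (auto simp: h_def)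
    have "(\<Sum>k=h+1..N. real k * indicator L k) \<le> (\<Sum>k=h+1..N. real N * indicator L k)"
      by (intro sum_mono mult_right_mono) auto
    also have "\<dots> = real N * card (L \<inter> {h+1..N})"
      by (simp add: sum_distrib_left[symmetric] sum_indicator_real_eq_card)
    also have "\<dots> \<le> real N * card (L \<inter> {h+1..<2*(h+1)})"
      using h by (intro mult_left_mono of_nat_mono card_mono) auto
    also have "\<dots> \<le> real N * real K" by (intro mult_left_mono of_nat_mono K) auto
    finally have 1: "(\<Sum>k=h+1..N. real k * indicator L k) \<le> real N * real K" .
    have "(\<Sum>k=1..h. real k * indicator L k) \<le> 2 * real K * real h"
      using less h by blast
    also have "\<dots> = real K * real (2 * h)" by simp
    also have "\<dots> \<le> real K * real N" using h by (intro mult_left_mono of_nat_mono) auto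
    finally have 2: "(\<Sum>k=1..h. real k * indicator L k) \<le> real K * real N" .
    have "{1..N} = {1..h} \<union> {h+1..N}" using h by auto
    then have "(\<Sum>k=1..N. real k * indicator L k) =
        (\<Sum>k=1..h. real k * indicator L k) + (\<Sum>k=h+1..N. real k * indicator L k)"
      by (simp only:) (rule sum.union_disjoint, auto)
    with 1 2 show ?thesis by (simp add: algebra_simps)
  qed simp
qed

text \<open>Summation by parts: the weights \<open>r ^ k\<close> are nonnegative and decreasing, so
  domination of partial sums survives weighting.\<close>

lemma sum_mult_power_mono:
  fixes b c :: "nat \<Rightarrow> real"
  assumes le: "\<And>n. (\<Sum>k<n. b k) \<le> (\<Sum>k<n. c k)" and r: "0 \<le> r" "r \<le> 1"
  shows "(\<Sum>k<n. b k * r ^ k) \<le> (\<Sum>k<n. c k * r ^ k)"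
proof -
  define d where "d k = c k - b k" for k
  have pos: "(\<Sum>k<n. d k) \<ge> 0" for n
    using le by (simp add: d_def sum_subtractf)
  \<comment> \<open>Nonnegativity of the weighted sum alone would not carry through the induction;
    this stronger lower bound does.\<close>
  have "r ^ n * (\<Sum>k<n. d k) \<le> (\<Sum>k<n. d k * r ^ k)"
  proof (induction n)
    case (Suc n)
    have "r ^ Suc n * (\<Sum>k<Suc n. d k) \<le> r ^ n * (\<Sum>k<Suc n. d k)"
      using r pos[of "Suc n"] by (intro mult_right_mono power_decreasing) auto
    also have "\<dots> = r ^ n * (\<Sum>k<n. d k) + d n * r ^ n" by (simp add: algebra_simps)
    also have "\<dots> \<le> (\<Sum>k<Suc n. d k * r ^ k)" using Suc by simp
    finally show ?case .
  qed simp
  moreover have "0 \<le> r ^ n * (\<Sum>k<n. d k)" using r pos by simp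
  ultimately show ?thesis by (simp add: d_def left_diff_distrib sum_subtractf)
qed

text \<open>By the triangle inequality the derivative at \<open>z\<close> is bounded by the same
  series at \<open>norm z\<close>. Its coefficients have partial sums at most
  \<open>2 * K * n\<close>, so comparison with the constant coefficients \<open>2 * K\<close> leaves
  a geometric series.\<close>

lemma bloch_if_dyadically_bounded:
  assumes "dyadically_bounded L"
  shows "power_series (indicator L) \<in> bloch_space"
proof -
  obtain K where K: "\<And>x. card (L \<inter> {x..<2 * x}) \<le> K"
    using assms unfolding dyadically_bounded_def by blast
  have bound: "(1 - norm z) * norm (deriv (power_series (indicator L)) z) \<le> 2 * real K"
    if z: "norm z < 1" for z
  proof -
    let ?b = "\<lambda>n. real (Suc n) * indicator L (Suc n)"
    define r where "r = norm z"
    have r: "0 \<le> r" "r < 1" using z by (auto simp: r_def)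
    have sm: "summable (\<lambda>n. ?b n * r ^ n)"
      using summable_derivative_indicator_series[of r L] r by simp
    have nrm: "norm (of_nat (Suc n) * indicator L (Suc n) * z ^ n) = ?b n * r ^ n" for n
      by (simp add: norm_mult norm_power r_def indicator_def del: of_nat_Suc)
    have "norm (deriv (power_series (indicator L)) z) \<le> (\<Sum>n. ?b n * r ^ n)"
      unfolding deriv_power_series_indicator[OF z]
      using summable_norm[of "\<lambda>n. of_nat (Suc n) * indicator L (Suc n) * z ^ n"] sm
      by (simp only: nrm)
    also have "\<dots> \<le> 2 * real K / (1 - r)"
    proof (rule suminf_le_const[OF sm])
      fix n
      have "(\<Sum>k<n. ?b k) \<le> (\<Sum>k<n. 2 * real K)" for n
        using sum_indicator_le_linear[OF K, of n] by (simp add: sum.atLeast1_atMost_eq mult.commute)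
      then have "(\<Sum>k<n. ?b k * r ^ k) \<le> (\<Sum>k<n. 2 * real K * r ^ k)"
        using r by (intro sum_mult_power_mono) auto
      also have "\<dots> = 2 * real K * ((1 - r ^ n) / (1 - r))"
        using r by (simp add: sum_distrib_left[symmetric] sum_gp_strict)
      also have "\<dots> \<le> 2 * real K * (1 / (1 - r))"
        using r by (intro mult_left_mono divide_right_mono) auto
      finally show "(\<Sum>k<n. ?b k * r ^ k) \<le> 2 * real K / (1 - r)" by simp
    qed
    finally show ?thesis using r by (simp add: field_simps r_def)
  qed
  have "bloch_norm (power_series (indicator L)) \<le> ereal (2 * real K)"
    unfolding bloch_norm_def by (intro SUP_least) (use bound in auto)
  then have "bloch_norm (power_series (indicator L)) < \<infinity>"
    by (rule order.strict_trans1) simp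
  then show ?thesis by (simp add: bloch_space_def holomorphic_power_series_indicator)
qed

text \<open>On the positive radius all terms of the derivative are nonnegative, so the exponents in
  \<open>{x..<2 * x}\<close> alone already obey the Bloch bound. At
  \<open>r = 1 - 1 / (2 * x)\<close> each of them contributes at least \<open>x / 4\<close>, and the
  factor \<open>1 - r = 1 / (2 * x)\<close> turns this into \<open>1 / 8\<close>.\<close>

lemma dyadically_bounded_if_bloch:
  assumes "power_series (indicator L) \<in> bloch_space"
  shows "dyadically_bounded L"
proof -
  let ?f = "power_series (indicator L)"
  have "bloch_norm ?f < \<infinity>" using assms by (simp add: bloch_space_def)
  then obtain C where C: "bloch_norm ?f \<le> ereal C"
    by (cases "bloch_norm ?f") auto
  have bloch: "(1 - norm z) * norm (deriv ?f z) \<le> C" if "norm z < 1" for z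
  proof -
    have "ereal ((1 - norm z) * norm (deriv ?f z)) \<le> bloch_norm ?f"
      unfolding bloch_norm_def by (rule SUP_upper) (use that in auto)
    with C have "ereal ((1 - norm z) * norm (deriv ?f z)) \<le> ereal C" by (rule order_trans[rotated])
    then show ?thesis by simp
  qed
  have "real (card (L \<inter> {x..<2 * x})) \<le> 8 * C" for x
  proof (cases "x = 0")
    case True
    \<comment> \<open>The interval is empty; the Bloch bound at 0 supplies the remaining fact that
      \<open>C\<close> is nonnegative.\<close>
    then show ?thesis using bloch[of 0] order_trans[OF norm_ge_zero, of "deriv ?f 0" C] by simp
  next
    case False
    then have x: "real x \<ge> 1" by simp
    define r where "r = 1 - 1 / (2 * real x)"
    have r: "0 \<le> r" "r < 1" using x by (auto simp: r_def field_simps)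
    let ?b = "\<lambda>n. real (Suc n) * indicator L (Suc n)"
    have sm: "summable (\<lambda>n. ?b n * r ^ n)"
      using summable_derivative_indicator_series[of r L] r by simp
    have "deriv ?f (of_real r) = of_real (\<Sum>n. ?b n * r ^ n)"
    proof -
      have "of_real (\<Sum>n. ?b n * r ^ n) = (\<Sum>n. of_real (?b n * r ^ n) :: complex)"
        by (rule suminf_of_real[OF sm])
      also have "(\<lambda>n. of_real (?b n * r ^ n) :: complex) =
          (\<lambda>n. of_nat (Suc n) * indicator L (Suc n) * of_real r ^ n)"
        by (auto simp: indicator_def)
      finally show ?thesis using r by (simp add: deriv_power_series_indicator)
    qed
    then have "norm (deriv ?f (of_real r)) \<ge> (\<Sum>n. ?b n * r ^ n)" by simp
    then have "(1 - r) * (\<Sum>n. ?b n * r ^ n) \<le> (1 - r) * norm (deriv ?f (of_real r))"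
      using r by (intro mult_left_mono) auto
    also have "\<dots> \<le> C" using bloch[of "of_real r"] r by simp
    finally have 1: "(1 - r) * (\<Sum>n. ?b n * r ^ n) \<le> C" .
    \<comment> \<open>Bernoulli's inequality gives \<open>1 - x / (2 * x)\<close>; squaring covers
      all exponents up to \<open>2 * x\<close>.\<close>
    have half: "r ^ x \<ge> 1 / 2"
      using Bernoulli_inequality[of "- (1 / (2 * real x))" x] x by (simp add: r_def field_simps)
    have pw: "r ^ n \<ge> 1 / 4" if "n \<le> 2 * x" for n
    proof -
      have "1 / 4 \<le> r ^ x * r ^ x" using mult_mono[OF half half] r by simp
      also have "\<dots> = r ^ (2 * x)" by (simp add: power_add[symmetric] mult_2)
      also have "\<dots> \<le> r ^ n" using that r by (intro power_decreasing) auto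
      finally show ?thesis .
    qed
    have "real (card (L \<inter> {x..<2 * x})) * (real x * (1 / 4)) =
        (\<Sum>k\<in>{x..<2 * x}. real x * (1 / 4) * indicator L k)"
      unfolding sum_distrib_left[symmetric]
      by (simp only: sum_indicator_real_eq_card finite_atLeastLessThan mult.commute)
    also have "\<dots> \<le> (\<Sum>k\<in>{x..<2 * x}. real k * r ^ (k - 1) * indicator L k)"
      using pw by (intro sum_mono mult_right_mono mult_mono) auto
    also have "\<dots> = (\<Sum>k\<in>{x - 1..<2 * x - 1}. ?b k * r ^ k)"
      by (rule sum.reindex_bij_witness[of _ Suc "\<lambda>k. k - 1"]) (use False in auto)
    also have "\<dots> \<le> (\<Sum>n. ?b n * r ^ n)"
      using r by (intro sum_le_suminf[OF sm]) auto
    finally have "(1 - r) * (real (card (L \<inter> {x..<2 * x})) * (real x * (1 / 4))) \<le> C"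
      using 1 r by (meson diff_ge_0_iff_ge less_imp_le mult_left_mono order_trans)
    then show ?thesis using x by (simp add: r_def)
  qed
  then have "card (L \<inter> {x..<2 * x}) \<le> nat \<lceil>8 * C\<rceil>" for x
    by (meson le_nat_iff real_nat_ceiling_ge of_nat_le_iff order_trans)
  then show ?thesis unfolding dyadically_bounded_def by blast
qed

text \<open>This equivalence is deterministic; chance enters only through the dyadic counts of the
  random set.\<close>

theorem power_series_indicator_in_bloch_iff:
  "power_series (indicator L) \<in> bloch_space \<longleftrightarrow> finite_union_of_lacunary L"
  using bloch_if_dyadically_bounded dyadically_bounded_if_bloch
    finite_union_of_lacunary_iff_dyadically_bounded by blast

section \<open>Independence over blocks and hitting probabilities\<close>

text \<open>Disjoint blocks of an independent family generate independent sigma-algebras. This is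
  applied to singletons, to the pieces of one dyadic interval, and to the dyadic intervals
  themselves.\<close>

lemma (in prob_space) prob_INT_blocks:
  assumes indep: "indep_events E UNIV"
    and disj: "disjoint_family_on B J" and J: "finite J" "J \<noteq> {}"
    and A: "\<And>j. j \<in> J \<Longrightarrow> A j \<in> sigma_sets (space M) (E ` B j)"
  shows "prob (\<Inter>j\<in>J. A j) = (\<Prod>j\<in>J. prob (A j))"
proof -
  have "indep_sets (\<lambda>i. {E i}) UNIV" using indep by (simp add: indep_events_def_alt)
  then have "indep_sets (\<lambda>i. {E i}) (\<Union>j\<in>J. B j)" by (rule indep_sets_mono_index[rotated]) simp
  then have "indep_sets (\<lambda>j. sigma_sets (space M) (\<Union>i\<in>B j. {E i})) J"
    by (rule indep_sets_collect_sigma) (auto simp: Int_stable_def disj)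
  then show ?thesis
    by (rule indep_setsD) (use J A in \<open>auto simp: UNION_singleton_eq_range\<close>)
qed

text \<open>Each factor equals \<open>n / (n + 1)\<close>.\<close>

lemma prod_one_minus_inverse_telescope:
  assumes "a < b"
  shows "(\<Prod>n\<in>{a..<b}. 1 - 1 / (real n + 1)) = real a / real b"
  using assms
proof (induction b)
  case (Suc b)
  show ?case
  proof (cases "a = b")
    case False
    then have "a < b" using Suc.prems by simp
    then show ?thesis using Suc.IH by (simp add: field_simps)
  qed (simp add: field_simps)
qed simp

lemma (in prob_space) prob_UN_block:
  assumes indep: "indep_events E UNIV" and pr: "\<And>n. prob (E n) = 1 / (real n + 1)"
    and "a < b"
  shows "prob (\<Union>n\<in>{a..<b}. E n) = 1 - real a / real b"
proof -
  have ev: "E n \<in> events" for n using indep by (auto simp: indep_events_def)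
  have "prob (\<Inter>n\<in>{a..<b}. space M - E n) = (\<Prod>n\<in>{a..<b}. prob (space M - E n))"
    by (rule prob_INT_blocks[OF indep, where B = "\<lambda>n. {n}"])
      (use \<open>a < b\<close> in \<open>auto simp: disjoint_family_on_def intro: sigma_sets.intros\<close>)
  also have "\<dots> = real a / real b"
    using \<open>a < b\<close> by (simp add: prob_compl ev pr prod_one_minus_inverse_telescope)
  also have "(\<Inter>n\<in>{a..<b}. space M - E n) = space M - (\<Union>n\<in>{a..<b}. E n)"
    using \<open>a < b\<close> by auto
  finally show ?thesis using ev by (subst (asm) prob_compl) auto
qed

text \<open>The interval \<open>[ms, 2ms)\<close> is cut into \<open>m\<close> pieces of length \<open>s\<close>. Each piece is hit with
  probability at least \<open>1/(2m)\<close>, uniformly in \<open>s\<close>.\<close>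

lemma (in prob_space) prob_all_pieces_hit:
  assumes indep: "indep_events E UNIV" and pr: "\<And>n. prob (E n) = 1 / (real n + 1)"
    and m: "m > 0" and s: "s > 0"
  shows "prob (\<Inter>i\<in>{..<m}. \<Union>n\<in>{(m + i) * s..<(m + i + 1) * s}. E n) \<ge> (1 / (2 * real m)) ^ m"
proof -
  let ?I = "\<lambda>i. {(m + i) * s..<(m + i + 1) * s}"
  have ev: "E n \<in> events" for n using indep by (auto simp: indep_events_def)
  have "prob (\<Inter>i\<in>{..<m}. \<Union>n\<in>?I i. E n) = (\<Prod>i\<in>{..<m}. prob (\<Union>n\<in>?I i. E n))"
  proof (rule prob_INT_blocks[OF indep, where B = ?I])
    show "disjoint_family_on ?I {..<m}"
      unfolding disjoint_family_on_def
    proof safe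
      fix i j n assume "i \<noteq> j" and n: "n \<in> ?I i" "n \<in> ?I j"
      \<comment> \<open>The quotient by \<open>s\<close> recovers the index of the piece containing
        \<open>n\<close>.\<close>
      have "n div s = m + k" if "n \<in> ?I k" for k
        using that s by (intro div_nat_eqI) (auto simp: algebra_simps)
      from this[OF n(1)] this[OF n(2)] \<open>i \<noteq> j\<close> show "n \<in> {}" by simp
    qed
    fix i
    interpret S: sigma_algebra "space M" "sigma_sets (space M) (E ` ?I i)"
      by (rule sigma_algebra_sigma_sets) (use ev sets.sets_into_space in blast)
    show "(\<Union>n\<in>?I i. E n) \<in> sigma_sets (space M) (E ` ?I i)"
      by (intro S.finite_UN) (auto intro: sigma_sets.Basic)
  qed (use m in auto)
  also have "\<dots> \<ge> (\<Prod>i\<in>{..<m}. 1 / (2 * real m))"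
  proof (intro prod_mono conjI)
    fix i assume i: "i \<in> {..<m}"
    have "prob (\<Union>n\<in>?I i. E n) = 1 - real ((m + i) * s) / real ((m + i + 1) * s)"
      by (rule prob_UN_block[OF indep pr]) (use s in auto)
    \<comment> \<open>The length \<open>s\<close> cancels here, whence the uniformity in
      \<open>s\<close>.\<close>
    also have "\<dots> = 1 - real (m + i) / real (m + i + 1)"
      using s by (simp only: of_nat_mult) (simp add: mult_divide_mult_cancel_right)
    also have "\<dots> = 1 / real (m + i + 1)" by (simp add: field_simps)
    also have "\<dots> \<ge> 1 / (2 * real m)" using i m by (intro divide_left_mono) auto
    finally show "1 / (2 * real m) \<le> prob (\<Union>n\<in>?I i. E n)" .
  qed simp
  finally show ?thesis by simp
qed

text \<open>One element chosen from each piece gives \<open>m\<close> distinct elements, since their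
  quotients by \<open>s\<close> differ.\<close>

lemma le_card_if_pieces_hit:
  assumes "\<And>i. i < m \<Longrightarrow> L \<inter> {(m + i) * s..<(m + i + 1) * s} \<noteq> {}"
  shows "m \<le> card (L \<inter> {m * s..<2 * (m * s)})"
proof -
  have "\<exists>n. n \<in> L \<and> (m + i) * s \<le> n \<and> n < (m + i + 1) * s" if "i < m" for i
    using assms[OF that] by auto
  then obtain g where g: "\<And>i. i < m \<Longrightarrow> g i \<in> L \<and> (m + i) * s \<le> g i \<and> g i < (m + i + 1) * s"
    by metis
  have "g i div s = m + i" if "i < m" for i
    using g[OF that] by (intro div_nat_eqI) (auto simp: algebra_simps)
  then have inj: "inj_on g {..<m}"
    by (intro inj_onI) (metis add_left_cancel lessThan_iff)
  have "g ` {..<m} \<subseteq> L \<inter> {m * s..<2 * (m * s)}"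
  proof
    fix n assume "n \<in> g ` {..<m}"
    then obtain i where i: "i < m" "n = g i" by auto
    have "m * s \<le> (m + i) * s" by simp
    moreover have "(m + i + 1) * s \<le> (2 * m) * s" using i by (intro mult_right_mono) auto
    ultimately have "m * s \<le> n" "n < 2 * (m * s)" using g[OF i(1)] i(2) by linarith+
    then show "n \<in> L \<inter> {m * s..<2 * (m * s)}" using g[OF i(1)] i(2) by simp
  qed
  then have "card (g ` {..<m}) \<le> card (L \<inter> {m * s..<2 * (m * s)})"
    by (intro card_mono) auto
  then show ?thesis by (simp add: card_image inj)
qed

section \<open>Almost sure unboundedness of the dyadic counts\<close>

lemma (in prob_space) AE_exists_rich_dyadic_interval:
  assumes indep: "indep_events E UNIV" and pr: "\<And>n. prob (E n) = 1 / (real n + 1)"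
    and m: "m > 0"
  shows "AE \<omega> in M. \<exists>x. m \<le> card ({n. \<omega> \<in> E n} \<inter> {x..<2 * x})"
proof -
  define s where "s j = (2 :: nat) ^ j" for j
  define Q where "Q j = (\<Inter>i\<in>{..<m}. \<Union>n\<in>{(m + i) * s j..<(m + i + 1) * s j}. E n)" for j
  define p where "p = (1 / (2 * real m)) ^ m"
  have ev: "E n \<in> events" for n using indep by (auto simp: indep_events_def)
  have Q_ev: "Q j \<in> events" for j
    unfolding Q_def using m ev by (intro sets.finite_INT) auto
  have p: "0 < p" "p \<le> 1" using m by (auto simp: p_def power_le_one_iff)
  have Qp: "prob (Q j) \<ge> p" for j
    unfolding Q_def p_def by (rule prob_all_pieces_hit[OF indep pr m]) (simp add: s_def)
  \<comment> \<open>\<open>Q j\<close> depends only on the indices in \<open>?B j\<close>. As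
    \<open>s\<close> doubles at each step, these blocks are disjoint and the events
    \<open>Q j\<close> are independent.\<close>
  let ?B = "\<lambda>j. {m * s j..<2 * (m * s j)}"
  have disj: "disjoint_family_on ?B J" for J
  proof -
    have "?B j \<inter> ?B k = {}" if "j < k" for j k
    proof -
      have "2 * s j = s (Suc j)" by (simp add: s_def)
      also have "\<dots> \<le> s k" using that unfolding s_def by (intro power_increasing) auto
      finally have "m * (2 * s j) \<le> m * s k" by (rule mult_le_mono2)
      then show ?thesis by (auto simp: algebra_simps)
    qed
    then show ?thesis unfolding disjoint_family_on_def
      by (metis inf_commute linorder_neqE_nat)
  qed
  have Q_sig: "Q j \<in> sigma_sets (space M) (E ` ?B j)" for j
  proof -
    interpret S: sigma_algebra "space M" "sigma_sets (space M) (E ` ?B j)"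
      by (rule sigma_algebra_sigma_sets) (use ev sets.sets_into_space in blast)
    show ?thesis unfolding Q_def
    proof (intro S.finite_INT S.finite_UN)
      fix i n assume i: "i \<in> {..<m}" and n: "n \<in> {(m + i) * s j..<(m + i + 1) * s j}"
      have "m * s j \<le> (m + i) * s j" by simp
      moreover have "(m + i + 1) * s j \<le> (2 * m) * s j" using i by (intro mult_right_mono) auto
      ultimately have "m * s j \<le> n" "n < 2 * (m * s j)"
        using n unfolding atLeastLessThan_iff by linarith+
      then show "E n \<in> sigma_sets (space M) (E ` ?B j)" by (auto intro: sigma_sets.Basic)
    qed (use m in auto)
  qed
  have none: "prob (\<Inter>j\<in>{..<J}. space M - Q j) \<le> (1 - p) ^ J" if "J > 0" for J
  proof -
    have "prob (\<Inter>j\<in>{..<J}. space M - Q j) = (\<Prod>j\<in>{..<J}. prob (space M - Q j))"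
      by (rule prob_INT_blocks[OF indep disj])
        (use that Q_sig in \<open>auto intro: sigma_sets.Compl\<close>)
    also have "\<dots> \<le> (\<Prod>j\<in>{..<J}. 1 - p)"
      using Qp by (intro prod_mono) (auto simp: prob_compl[OF Q_ev])
    finally show ?thesis by simp
  qed
  \<comment> \<open>The event that every \<open>Q j\<close> fails. It lies in all the finite
    intersections bounded by \<open>none\<close>, so its probability is at most a power of
    \<open>1 - p\<close> with arbitrarily large exponent.\<close>
  define Z where "Z = (\<Inter>j. space M - Q j)"
  have Z_ev: "Z \<in> events" unfolding Z_def using Q_ev by (intro sets.countable_INT) auto
  have Z_le: "prob Z \<le> (1 - p) ^ Suc J" for J
  proof -
    have "prob Z \<le> prob (\<Inter>j\<in>{..<Suc J}. space M - Q j)"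
      by (rule finite_measure_mono) (use Q_ev in \<open>auto simp: Z_def intro!: sets.finite_INT\<close>)
    also have "\<dots> \<le> (1 - p) ^ Suc J" by (rule none) simp
    finally show ?thesis .
  qed
  have "(\<lambda>J. (1 - p) ^ Suc J) \<longlonglongrightarrow> 0"
    using p by (intro LIMSEQ_Suc LIMSEQ_realpow_zero) auto
  then have "prob Z \<le> 0" by (rule LIMSEQ_le_const) (use Z_le in auto)
  then have "Z \<in> null_sets M" using Z_ev
    by (intro null_setsI) (auto simp: emeasure_eq_measure measure_le_0_iff)
  then have "AE \<omega> in M. \<omega> \<notin> Z" by (rule AE_not_in)
  then show ?thesis
  proof (rule AE_mp, intro AE_I2 impI)
    fix \<omega> assume "\<omega> \<in> space M" "\<omega> \<notin> Z"
    then obtain j where j: "\<omega> \<in> Q j" by (auto simp: Z_def)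
    have "m \<le> card ({n. \<omega> \<in> E n} \<inter> {m * s j..<2 * (m * s j)})"
      by (rule le_card_if_pieces_hit) (use j in \<open>auto simp: Q_def\<close>)
    then show "\<exists>x. m \<le> card ({n. \<omega> \<in> E n} \<inter> {x..<2 * x})" by blast
  qed
qed

text \<open>There are only countably many candidate bounds \<open>K\<close>, so the exceptional null
  sets can be united; \<open>Suc K\<close> elements exceed the bound \<open>K\<close>.\<close>

lemma (in prob_space) AE_not_dyadically_bounded:
  assumes indep: "indep_events E UNIV" and pr: "\<And>n. prob (E n) = 1 / (real n + 1)"
  shows "AE \<omega> in M. \<not> dyadically_bounded {n. \<omega> \<in> E n}"
proof -
  have "AE \<omega> in M. \<forall>K. \<exists>x. Suc K \<le> card ({n. \<omega> \<in> E n} \<inter> {x..<2 * x})"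
    using AE_exists_rich_dyadic_interval[OF assms] by (subst AE_all_countable) auto
  then show ?thesis
    by eventually_elim (auto simp: dyadically_bounded_def not_le Suc_le_eq)
qed

text \<open>The last conjunct expresses the equivalence outcome by outcome. Since the hypotheses
  force the values 0 and 1 only almost surely, it is restricted to outcomes at which all values are
  0 or 1.\<close>

theorem proposition1p4:
  fixes M :: "'a measure" and \<xi> :: "nat \<Rightarrow> 'a \<Rightarrow> real"
  assumes "prob_space M"
    and "prob_space.indep_vars M (\<lambda>_. borel) \<xi> UNIV"
    and "\<And>n. measure M {\<omega> \<in> space M. \<xi> n \<omega> = 1} = 1 / (real n + 1)"
    and "\<And>n. measure M {\<omega> \<in> space M. \<xi> n \<omega> = 0} = 1 - 1 / (real n + 1)"
  shows "(AE \<omega> in M. power_series (\<lambda>n. \<xi> n \<omega>) \<notin> bloch_space)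
    \<and> (AE \<omega> in M. \<not> finite_union_of_lacunary {n. \<xi> n \<omega> = 1})
    \<and> (\<forall>\<omega>\<in>space M. (\<forall>n. \<xi> n \<omega> \<in> {0, 1}) \<longrightarrow>
          (power_series (\<lambda>n. \<xi> n \<omega>) \<notin> bloch_space
            \<longleftrightarrow> \<not> finite_union_of_lacunary {n. \<xi> n \<omega> = 1}))"
proof -
  interpret prob_space M by fact
  have rv: "random_variable borel (\<xi> n)" for n
    using assms(2) by (auto simp: indep_vars_def)
  note [measurable] = rv
  define E where "E n = {\<omega> \<in> space M. \<xi> n \<omega> = 1}" for n
  have E_ev: "E n \<in> events" for n unfolding E_def by measurable
  have prE: "prob (E n) = 1 / (real n + 1)" for n using assms(3) by (simp add: E_def)
  have "indep_events (\<lambda>n. {\<omega> \<in> space M. \<xi> n \<omega> = 1}) UNIV"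
    by (rule indep_eventsI_indep_vars[OF assms(2)]) simp
  then have indep: "indep_events E UNIV" by (simp add: E_def[abs_def])
  have "AE \<omega> in M. \<not> dyadically_bounded {n. \<omega> \<in> E n}"
    by (rule AE_not_dyadically_bounded[OF indep prE])
  then have not_fin: "AE \<omega> in M. \<not> finite_union_of_lacunary {n. \<xi> n \<omega> = 1}"
    using AE_space
    by eventually_elim (simp add: E_def finite_union_of_lacunary_iff_dyadically_bounded)
  have iff: "power_series (\<lambda>n. \<xi> n \<omega>) \<in> bloch_space \<longleftrightarrow> finite_union_of_lacunary {n. \<xi> n \<omega> = 1}"
    if "\<forall>n. \<xi> n \<omega> \<in> {0, 1}" for \<omega>
  proof -
    have "(\<lambda>n. \<xi> n \<omega>) = indicator {n. \<xi> n \<omega> = 1}"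
      using that by (auto simp: indicator_def fun_eq_iff)
    then show ?thesis by (simp add: power_series_indicator_in_bloch_iff)
  qed
  \<comment> \<open>The masses at 1 and 0 add up to 1, so for each \<open>n\<close> other values
    occur with probability zero; countably many such null sets are then combined.\<close>
  have "AE \<omega> in M. \<xi> n \<omega> \<in> {0, 1}" for n
  proof -
    have "prob {\<omega> \<in> space M. \<xi> n \<omega> \<in> {0, 1}} =
        prob ({\<omega> \<in> space M. \<xi> n \<omega> = 1} \<union> {\<omega> \<in> space M. \<xi> n \<omega> = 0})"
      by (rule arg_cong[where f = prob]) auto
    also have "\<dots> = prob {\<omega> \<in> space M. \<xi> n \<omega> = 1} + prob {\<omega> \<in> space M. \<xi> n \<omega> = 0}"
      by (rule finite_measure_Union) auto
    also have "\<dots> = 1" by (simp add: assms(3,4))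
    finally show ?thesis by (subst (asm) prob_Collect_eq_1) auto
  qed
  then have "AE \<omega> in M. \<forall>n. \<xi> n \<omega> \<in> {0, 1}" by (simp add: AE_all_countable)
  with not_fin have "AE \<omega> in M. power_series (\<lambda>n. \<xi> n \<omega>) \<notin> bloch_space"
    by eventually_elim (simp add: iff)
  with not_fin show ?thesis using iff by blast
qed

end
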